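(* If $(f_n(q))_{n}$ is a $q$-holonomic sequence of rational functions of $q$, then the sequence of derivatives $\left(\frac{d}{dq}f_n(q)\right)_{n}$ is $q$-holonomic.
   Context: A sequence $(f_n(q))_{n\in\mathbb{N}}$ of rational functions of $q$ is $q$-holonomic if it satisfies a linear recursion of the form $$c_d(q^n,q)f_{n+d}(q)+\dots+c_0(q^n,q)f_n(q)=0$$ for all $n$, where $c_j(u,v)\in K[u,v]$ are polynomials in two variables $u$ and $v$ with coefficients in a number field $K$, for $j=0,\dots,d$, with $c_d\neq0$. *)

theory Defs
  imports
    "HOL-Computational_Algebra.Polynomial"
    "HOL-Computational_Algebra.Fraction_Field"
begin

text \<open>A number field is a field of characteristic zero that is finite-dimensional as a vector
  space over the rationals.\<close>

class number_field = field_char_0 +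
  assumes finite_dim_over_rat:
    "\<exists>B. finite B \<and> (\<forall>x. \<exists>r :: 'a \<Rightarrow> rat. x = (\<Sum>b\<in>B. of_rat (r b) * b))"

instance rat :: number_field
proof
  show "\<exists>B :: rat set. finite B \<and> (\<forall>x. \<exists>r :: rat \<Rightarrow> rat. x = (\<Sum>b\<in>B. of_rat (r b) * b))"
    by (intro exI[of _ "{1}"]) auto
qed

text \<open>The field \<open>K(q)\<close> of rational functions is \<open>'k poly fract\<close>.  The derivation \<open>d/dq\<close> on it is
  given by the quotient rule.\<close>

lift_definition rat_deriv :: "'k :: field_char_0 poly fract \<Rightarrow> 'k poly fract"
  is "\<lambda>(a, b). (pderiv a * b - a * pderiv b, b * b)"
proof (clarsimp split: prod.splits)
  fix a b c d :: "'k poly"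
  assume eq: "a * d = c * b"
  have "pderiv (a * d) = pderiv (c * b)"
    by (simp only: eq)
  then have deq: "pderiv a * d + a * pderiv d = pderiv c * b + c * pderiv b"
    by (simp add: pderiv_mult algebra_simps)
  show "(pderiv a * b - a * pderiv b) * (d * d) = (pderiv c * d - c * pderiv d) * (b * b)"
    using eq deq by algebra
qed

lemma rat_deriv_Fract:
  "b \<noteq> 0 \<Longrightarrow> rat_deriv (Fract a b) = Fract (pderiv a * b - a * pderiv b) (b * b)"
  by transfer simp

text \<open>A polynomial \<open>c \<in> K[u, v]\<close> is encoded as an element of \<open>K[v][u]\<close>, that is, \<open>u\<close> is the outer
  and \<open>v\<close> the inner variable.  Identifying \<open>v\<close> with \<open>q\<close>, the outer evaluation of \<open>c\<close> at
  \<open>q ^ n\<close> is \<open>c(q ^ n, q) \<in> K[q]\<close>, which is then viewed in \<open>K(q)\<close>.\<close>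

definition qpow_subst :: "'k :: field_char_0 poly poly \<Rightarrow> nat \<Rightarrow> 'k poly fract" where
  "qpow_subst c n = Fract (poly c ([:0, 1:] ^ n)) 1"

definition q_holonomic :: "(nat \<Rightarrow> 'k :: number_field poly fract) \<Rightarrow> bool" where
  "q_holonomic f \<longleftrightarrow>
     (\<exists>(d :: nat) (c :: nat \<Rightarrow> 'k poly poly).
        c d \<noteq> 0 \<and> (\<forall>n. (\<Sum>j\<le>d. qpow_subst (c j) n * f (n + j)) = 0))"

end

theory Submission
  imports Defs "HOL-Library.Function_Algebras"
begin

text \<open>Let \<open>A = K[u, v]\<close> act on the sequences in \<open>K(q)\<close>, a polynomial
  \<open>c\<close> multiplying the \<open>n\<close>-th term by \<open>c(q ^ n, q)\<close>.  A sequence is \<open>q\<close>-holonomic iff its shifts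
  are linearly dependent over the domain \<open>A\<close>.  Let \<open>P = c\<^sub>0 + c\<^sub>1 S + \<dots> + c\<^sub>d S\<^sup>d\<close>, where \<open>S\<close> is the
  shift, be an operator with \<open>c\<^sub>d \<noteq> 0\<close> that annihilates \<open>f\<close>.  Differentiating \<open>P f = 0\<close> expresses
  \<open>q P f'\<close> through the shifts of \<open>f\<close>, but since
  \<open>q \<cdot> d/dq c(q ^ n, q) = n \<cdot> (u c\<^sub>u)(q ^ n, q) + (v c\<^sub>v)(q ^ n, q)\<close>, the coefficients also
  involve the factor \<open>n\<close>, which is not in \<open>A\<close>.  For this reason the sequence
  \<open>g = (n f\<^sub>n)\<^sub>n\<close> is carried along: \<open>P g\<close> is an \<open>A\<close>-combination of shifts of \<open>f\<close>, and \<open>q P f'\<close> is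
  an \<open>A\<close>-combination of shifts of \<open>f\<close> and \<open>g\<close>.

  Consider the \<open>3 d\<close> sequences \<open>S\<^sup>j f\<close>, \<open>S\<^sup>j g\<close>, \<open>S\<^sup>j f'\<close> with \<open>j < d\<close>, and the sequences some
  nonzero multiple of which lies in their \<open>A\<close>-span.  By the three relations and induction on the
  shift (\<open>shift_in_saturated\<close>), all shifts of \<open>f\<close>, then of \<open>g\<close>, then of \<open>f'\<close> are such sequences.
  Over a domain, more such elements than there are generators are linearly dependent
  (\<open>dependent_if_card_less\<close>); hence so are the shifts of \<open>f'\<close>.\<close>

section \<open>Linear dependence in modules over an integral domain\<close>

locale domain_module = module scale
  for scale :: "'a :: idom \<Rightarrow> 'b :: ab_group_add \<Rightarrow> 'b"  (infixr "*s" 75)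
begin

text \<open>The elements that become combinations of \<open>E\<close> after multiplication by a nonzero scalar.\<close>

definition saturation :: "'b set \<Rightarrow> 'b set" where
  "saturation E = {x. \<exists>a. a \<noteq> 0 \<and> a *s x \<in> span E}"

lemma in_saturation: "x \<in> E \<Longrightarrow> x \<in> saturation E"
  unfolding saturation_def by (auto intro!: exI[of _ 1] simp: span_base)

lemma subspace_saturation: "subspace (saturation E)"
proof (rule subspaceI)
  show "0 \<in> saturation E"
    unfolding saturation_def by (auto intro!: exI[of _ 1] simp: span_zero)
next
  fix x y assume "x \<in> saturation E" "y \<in> saturation E"
  then obtain a b where ab: "a \<noteq> 0" "a *s x \<in> span E" "b \<noteq> 0" "b *s y \<in> span E"
    unfolding saturation_def by auto
  have "(a * b) *s (x + y) = b *s (a *s x) + a *s (b *s y)"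
    by (simp add: scale_right_distrib mult.commute)
  also have "\<dots> \<in> span E"
    by (intro span_add span_scale ab)
  finally show "x + y \<in> saturation E"
    unfolding saturation_def using ab by (auto intro!: exI[of _ "a * b"])
next
  fix c x assume "x \<in> saturation E"
  then obtain a where a: "a \<noteq> 0" "a *s x \<in> span E"
    unfolding saturation_def by auto
  have "a *s (c *s x) = c *s (a *s x)"
    by (simp add: mult.commute)
  then show "c *s x \<in> saturation E"
    unfolding saturation_def using a span_scale[OF a(2), of c] by auto
qed

lemma saturation_cancel_scale:
  assumes "a \<noteq> 0" "a *s x \<in> saturation E"
  shows "x \<in> saturation E"
proof -
  obtain b where b: "b \<noteq> 0" "b *s (a *s x) \<in> span E"
    using assms(2) unfolding saturation_def by auto
  then show ?thesis
    using assms(1) unfolding saturation_def by (auto intro!: exI[of _ "b * a"])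
qed

text \<open>The proof is Gaussian elimination without division, one generator of \<open>E\<close> at a time.\<close>

lemma dependent_if_card_less:
  assumes "finite E" "finite I" "card E < card I" "\<And>i. i \<in> I \<Longrightarrow> x i \<in> saturation E"
  shows "\<exists>c. (\<exists>i\<in>I. c i \<noteq> 0) \<and> (\<Sum>i\<in>I. c i *s x i) = 0"
  using assms
proof (induction E arbitrary: I x rule: finite_induct)
  case empty
  then obtain i where i: "i \<in> I"
    by fastforce
  have "\<forall>i\<in>I. \<exists>a. a \<noteq> 0 \<and> a *s x i = 0"
    using empty.prems(3) unfolding saturation_def by auto
  then obtain a where "\<forall>i\<in>I. a i \<noteq> 0 \<and> a i *s x i = 0"
    by metis
  then show ?case
    using i by (intro exI[of _ a]) auto
next
  case (insert e E)
  have "\<forall>i\<in>I. \<exists>a b. a \<noteq> 0 \<and> a *s x i - b *s e \<in> span E"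
    using insert.prems(3) unfolding saturation_def span_insert by blast
  then obtain a b where ab: "\<And>i. i \<in> I \<Longrightarrow> a i \<noteq> 0"
      "\<And>i. i \<in> I \<Longrightarrow> a i *s x i - b i *s e \<in> span E"
    by metis
  show ?case
  proof (cases "\<forall>i\<in>I. b i = 0")
    case True
    then have "x i \<in> saturation E" if "i \<in> I" for i
      using ab[OF that] that unfolding saturation_def by auto
    then show ?thesis
      using insert.IH[of I x] insert.prems(1,2) insert.hyps by simp
  next
    case False
    then obtain k where k: "k \<in> I" "b k \<noteq> 0"
      by blast
    \<comment> \<open>The generator \<open>e\<close> cancels in these combinations.\<close>
    define z where "z i = b k *s (a i *s x i) - b i *s (a k *s x k)" for i
    have "z i \<in> saturation E" if i: "i \<in> I - {k}" for i
    proof -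
      have "z i = b k *s (a i *s x i - b i *s e) - b i *s (a k *s x k - b k *s e)"
        by (simp add: z_def scale_right_diff_distrib mult.commute)
      also have "\<dots> \<in> span E"
        using i k by (intro span_diff span_scale ab) auto
      finally show ?thesis
        unfolding saturation_def by (auto intro!: exI[of _ 1])
    qed
    moreover have "card E < card (I - {k})"
      using insert.prems(1,2) insert.hyps k by simp
    ultimately obtain c j where c: "j \<in> I - {k}" "c j \<noteq> 0" "(\<Sum>i\<in>I-{k}. c i *s z i) = 0"
      using insert.IH[of "I - {k}" z] insert.prems(1) by blast
    define c' where
      "c' i = (if i = k then - (\<Sum>i\<in>I-{k}. c i * b i * a k) else c i * b k * a i)" for i
    have "(\<Sum>i\<in>I. c' i *s x i) = c' k *s x k + (\<Sum>i\<in>I-{k}. (c i * b k * a i) *s x i)"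
      using insert.prems(1) k(1) by (simp add: sum.remove c'_def)
    also have "c' k *s x k = - (\<Sum>i\<in>I-{k}. (c i * b i * a k) *s x k)"
      by (simp add: c'_def scale_sum_left)
    also have "\<dots> + (\<Sum>i\<in>I-{k}. (c i * b k * a i) *s x i) = (\<Sum>i\<in>I-{k}. c i *s z i)"
      by (simp add: z_def scale_right_diff_distrib sum_subtractf mult.assoc)
    finally have "(\<Sum>i\<in>I. c' i *s x i) = 0"
      using c(3) by simp
    moreover have "c' j \<noteq> 0"
      using c(1,2) k(2) ab(1) by (simp add: c'_def)
    ultimately show ?thesis
      using c(1) by blast
  qed
qed

end

section \<open>The derivation of the rational function field\<close>

lemma rat_deriv_0 [simp]: "rat_deriv 0 = 0"
  by (simp add: Zero_fract_def rat_deriv_Fract eq_fract)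

lemma rat_deriv_add: "rat_deriv (x + y) = rat_deriv x + rat_deriv y"
proof (cases x, cases y)
  fix a b c d :: "'a poly"
  assume xy: "x = Fract a b" "b \<noteq> 0" "y = Fract c d" "d \<noteq> 0"
  show ?thesis
    using xy(2,4)
    by (simp add: xy rat_deriv_Fract eq_fract pderiv_mult pderiv_add) algebra
qed

lemma rat_deriv_mult: "rat_deriv (x * y) = rat_deriv x * y + x * rat_deriv y"
proof (cases x, cases y)
  fix a b c d :: "'a poly"
  assume xy: "x = Fract a b" "b \<noteq> 0" "y = Fract c d" "d \<noteq> 0"
  show ?thesis
    using xy(2,4)
    by (simp add: xy rat_deriv_Fract eq_fract pderiv_mult) algebra
qed

lemma rat_deriv_sum: "rat_deriv (sum h I) = (\<Sum>i\<in>I. rat_deriv (h i))"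
  by (induction I rule: infinite_finite_induct) (simp_all add: rat_deriv_add)

text \<open>The chain rule for \<open>c(y(q), q)\<close>.\<close>

lemma pderiv_poly_eval:
  "pderiv (poly c y) = poly (map_poly pderiv c) y + poly (pderiv c) y * pderiv y"
  by (induction c)
     (simp_all add: map_poly_pCons pderiv_add pderiv_mult pderiv_pCons algebra_simps)

lemma pderiv_X_power: "[:0, 1:] * pderiv ([:0, 1:] ^ n) = of_nat n * [:0, 1:] ^ n"
  by (induction n) (simp_all add: pderiv_mult pderiv_pCons algebra_simps)

section \<open>The module of sequences of rational functions\<close>

text \<open>The action of \<open>c \<in> K[u, v]\<close> on a sequence: multiplication of the \<open>n\<close>-th term by \<open>c(q ^ n, q)\<close>.\<close>

definition seq_scale ::
    "'k :: field_char_0 poly poly \<Rightarrow> (nat \<Rightarrow> 'k poly fract) \<Rightarrow> nat \<Rightarrow> 'k poly fract" where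
  "seq_scale c s = (\<lambda>n. qpow_subst c n * s n)"

definition shift :: "nat \<Rightarrow> (nat \<Rightarrow> 'a) \<Rightarrow> nat \<Rightarrow> 'a" where
  "shift i s = (\<lambda>n. s (n + i))"

lemma qpow_subst_add: "qpow_subst (a + b) n = qpow_subst a n + qpow_subst b n"
  by (simp add: qpow_subst_def)

lemma qpow_subst_mult: "qpow_subst (a * b) n = qpow_subst a n * qpow_subst b n"
  by (simp add: qpow_subst_def)

lemma qpow_subst_smult: "qpow_subst (smult p c) n = qpow_subst [:p:] n * qpow_subst c n"
  by (simp add: qpow_subst_def)

lemma qpow_subst_1: "qpow_subst 1 n = 1"
  by (simp add: qpow_subst_def One_fract_def)

lemma qpow_subst_of_nat: "qpow_subst (of_nat k) n = of_nat k"
  by (induction k) (simp_all add: qpow_subst_add qpow_subst_1, simp add: qpow_subst_def Zero_fract_def)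

interpretation seq: domain_module seq_scale
  by unfold_locales
    (simp_all add: seq_scale_def fun_eq_iff qpow_subst_add qpow_subst_mult qpow_subst_1 algebra_simps)

lemma sum_fun_apply: "(\<Sum>i\<in>I. h i) n = (\<Sum>i\<in>I. h i n)"
  for h :: "'i \<Rightarrow> 'n \<Rightarrow> 'a :: comm_monoid_add"
  by (induction I rule: infinite_finite_induct) simp_all

text \<open>The polynomial that arises from \<open>c\<close> when the index is shifted by \<open>k\<close>, which replaces
  \<open>u = q ^ n\<close> by \<open>v ^ k u\<close>.\<close>

definition coeff_shift :: "nat \<Rightarrow> 'k :: field_char_0 poly poly \<Rightarrow> 'k poly poly" where
  "coeff_shift k c = pcompose c [:0, [:0, 1:] ^ k:]"

lemma qpow_subst_coeff_shift: "qpow_subst (coeff_shift k c) n = qpow_subst c (n + k)"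
  by (simp add: qpow_subst_def coeff_shift_def poly_pcompose power_add)

lemma coeff_shift_nonzero: "c \<noteq> 0 \<Longrightarrow> coeff_shift k c \<noteq> 0"
  unfolding coeff_shift_def by (subst pcompose_eq_0_iff) simp_all

text \<open>The action of the operator \<open>\<Sum>j\<le>d. c j \<cdot> S\<^sup>j\<close>.\<close>

definition rec_op ::
    "nat \<Rightarrow> (nat \<Rightarrow> 'k :: field_char_0 poly poly) \<Rightarrow> (nat \<Rightarrow> 'k poly fract) \<Rightarrow> nat \<Rightarrow> 'k poly fract" where
  "rec_op d c s = (\<Sum>j\<le>d. seq_scale (c j) (shift j s))"

lemma rec_op_apply: "rec_op d c s n = (\<Sum>j\<le>d. qpow_subst (c j) n * s (n + j))"
  by (simp add: rec_op_def sum_fun_apply seq_scale_def shift_def)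

lemma q_holonomic_iff: "q_holonomic s \<longleftrightarrow> (\<exists>d c. c d \<noteq> 0 \<and> rec_op d c s = 0)"
  by (simp add: q_holonomic_def fun_eq_iff rec_op_apply)

lemma shift_rec_op:
  "shift k (rec_op d c s) = (\<Sum>j\<le>d. seq_scale (coeff_shift k (c j)) (shift (k + j) s))"
  by (simp add: fun_eq_iff shift_def rec_op_apply sum_fun_apply seq_scale_def
      qpow_subst_coeff_shift add.assoc)

lemma shift_rec_op_in_saturation:
  assumes "\<And>i. shift i s \<in> seq.saturation E"
  shows "shift k (rec_op d c s) \<in> seq.saturation E"
  unfolding shift_rec_op
  by (intro seq.subspace_sum seq.subspace_scale seq.subspace_saturation assms)

text \<open>The shift by \<open>k\<close> of \<open>rec_op d c s\<close> is a nonzero multiple of the shift of \<open>s\<close> by \<open>k + d\<close> plus a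
  combination of lower shifts.\<close>

lemma shift_in_saturated:
  assumes "c d \<noteq> 0"
    and rec: "\<And>k. shift k (rec_op d c s) \<in> seq.saturation E"
    and init: "\<And>j. j < d \<Longrightarrow> shift j s \<in> seq.saturation E"
  shows "shift i s \<in> seq.saturation E"
proof (induction i rule: less_induct)
  case (less i)
  show ?case
  proof (cases "i < d")
    case True
    then show ?thesis by (rule init)
  next
    case False
    define k where "k = i - d"
    have i: "i = k + d"
      using False by (simp add: k_def)
    let ?t = "\<lambda>j. seq_scale (coeff_shift k (c j)) (shift (k + j) s)"
    have "shift k (rec_op d c s) = (\<Sum>j<d. ?t j) + ?t d"
      unfolding shift_rec_op by (simp flip: lessThan_Suc_atMost)
    then have "?t d = shift k (rec_op d c s) - (\<Sum>j<d. ?t j)"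
      by simp
    also have "\<dots> \<in> seq.saturation E"
      using less.IH i
      by (intro seq.subspace_diff seq.subspace_sum seq.subspace_scale seq.subspace_saturation rec) auto
    finally show ?thesis
      using seq.saturation_cancel_scale[OF coeff_shift_nonzero[OF assms(1)]] i by blast
  qed
qed

lemma q_holonomic_if_shifts_in_saturation:
  assumes "finite E" "\<And>i. shift i s \<in> seq.saturation E"
  shows "q_holonomic s"
proof -
  obtain c j where j: "j \<le> card E" "c j \<noteq> 0"
      and c: "(\<Sum>i\<le>card E. seq_scale (c i) (shift i s)) = 0"
    using seq.dependent_if_card_less[of E "{..card E}" "\<lambda>i. shift i s"] assms by auto
  \<comment> \<open>The leading coefficient must be nonzero, so the relation is cut off at its last nonzero
    coefficient.\<close>
  define d where "d = Max {i. i \<le> card E \<and> c i \<noteq> 0}"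
  have "d \<in> {i. i \<le> card E \<and> c i \<noteq> 0}"
    unfolding d_def using j by (intro Max_in) auto
  then have d: "d \<le> card E" "c d \<noteq> 0"
    by auto
  have beyond: "c i = 0" if "i \<le> card E" "i > d" for i
  proof (rule ccontr)
    assume "c i \<noteq> 0"
    then have "i \<le> d"
      unfolding d_def using that by (intro Max_ge) auto
    then show False
      using that by simp
  qed
  have "rec_op d c s = (\<Sum>i\<le>card E. seq_scale (c i) (shift i s))"
    unfolding rec_op_def using d(1) beyond
    by (intro sum.mono_neutral_left) auto
  then show ?thesis
    unfolding q_holonomic_iff using c d(2) by auto
qed

section \<open>The recurrence of the derivative\<close>

text \<open>The Euler derivations \<open>u \<cdot> \<partial>/\<partial>u\<close> and \<open>v \<cdot> \<partial>/\<partial>v\<close> of \<open>K[u, v]\<close>; the coefficients of a polynomial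
  in \<open>u\<close> are polynomials in \<open>v\<close>.\<close>

definition u_deriv :: "'k :: field_char_0 poly poly \<Rightarrow> 'k poly poly" where
  "u_deriv c = [:0, 1:] * pderiv c"

definition v_deriv :: "'k :: field_char_0 poly poly \<Rightarrow> 'k poly poly" where
  "v_deriv c = [:[:0, 1:]:] * map_poly pderiv c"

lemma rat_deriv_qpow_subst:
  "qpow_subst [:[:0, 1:]:] n * rat_deriv (qpow_subst c n) =
     of_nat n * qpow_subst (u_deriv c) n + qpow_subst (v_deriv c) n"
proof -
  have of_nat: "(of_nat n :: 'a poly fract) = Fract (of_nat n) 1"
    by (simp add: of_nat_fract)
  let ?X = "[:0, 1:] :: 'a poly"
  have "?X * pderiv (poly c (?X ^ n)) =
      ?X * poly (map_poly pderiv c) (?X ^ n) + poly (pderiv c) (?X ^ n) * (?X * pderiv (?X ^ n))"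
    by (simp only: pderiv_poly_eval algebra_simps)
  also have "\<dots> = of_nat n * (?X ^ n * poly (pderiv c) (?X ^ n)) + ?X * poly (map_poly pderiv c) (?X ^ n)"
    by (simp only: pderiv_X_power algebra_simps)
  finally show ?thesis
    unfolding of_nat by (simp add: qpow_subst_def rat_deriv_Fract u_deriv_def v_deriv_def)
qed

text \<open>The factor \<open>n + j\<close> of \<open>f (n + j)\<close> splits into \<open>n\<close>, whose contribution is \<open>n\<close> times the
  recurrence of \<open>f\<close>, that is \<open>0\<close>, and \<open>j\<close>.\<close>

lemma rec_op_index_mult:
  assumes "rec_op d c f = 0"
  shows "rec_op d c (\<lambda>n. of_nat n * f n) = rec_op d (\<lambda>j. of_nat j * c j) f"
proof
  fix n
  have "rec_op d c (\<lambda>n. of_nat n * f n) n =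
      of_nat n * rec_op d c f n + rec_op d (\<lambda>j. of_nat j * c j) f n"
    by (simp add: rec_op_apply qpow_subst_mult qpow_subst_of_nat sum_distrib_left
        algebra_simps flip: sum.distrib)
  then show "rec_op d c (\<lambda>n. of_nat n * f n) n = rec_op d (\<lambda>j. of_nat j * c j) f n"
    using assms by simp
qed

text \<open>In the derivative of the recurrence, multiplied by \<open>q\<close>, the factor \<open>n\<close> in front of
  \<open>f (n + j)\<close> is written as \<open>(n + j) - j\<close>, and \<open>n + j\<close> is absorbed into the sequence \<open>n f\<^sub>n\<close>.\<close>

lemma rec_op_rat_deriv:
  assumes "rec_op d c f = 0"
  shows "rec_op d (\<lambda>j. [:[:0, 1:]:] * c j) (\<lambda>n. rat_deriv (f n)) =
    rec_op d (\<lambda>j. of_nat j * u_deriv (c j) - v_deriv (c j)) f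
      - rec_op d (\<lambda>j. u_deriv (c j)) (\<lambda>n. of_nat n * f n)"
proof
  fix n
  let ?q = "qpow_subst [:[:0, 1:]:] n :: 'a poly fract"
  have "0 = ?q * rat_deriv (rec_op d c f n)"
    using assms by simp
  also have "\<dots> = (\<Sum>j\<le>d. (?q * rat_deriv (qpow_subst (c j) n)) * f (n + j))
      + rec_op d (\<lambda>j. [:[:0, 1:]:] * c j) (\<lambda>n. rat_deriv (f n)) n"
    by (simp add: rec_op_apply rat_deriv_sum rat_deriv_mult sum.distrib sum_distrib_left
        qpow_subst_smult algebra_simps)
  also have "(\<Sum>j\<le>d. (?q * rat_deriv (qpow_subst (c j) n)) * f (n + j)) =
      rec_op d (\<lambda>j. u_deriv (c j)) (\<lambda>n. of_nat n * f n) n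
      - rec_op d (\<lambda>j. of_nat j * u_deriv (c j) - v_deriv (c j)) f n"
  proof -
    have diff: "qpow_subst (a - b) n = qpow_subst a n - qpow_subst b n" for a b :: "'a poly poly"
      by (simp add: qpow_subst_def)
    show ?thesis
      unfolding rat_deriv_qpow_subst
      by (simp add: rec_op_apply diff qpow_subst_mult qpow_subst_of_nat algebra_simps
          flip: sum.distrib sum_subtractf)
  qed
  finally show "rec_op d (\<lambda>j. [:[:0, 1:]:] * c j) (\<lambda>n. rat_deriv (f n)) n =
    (rec_op d (\<lambda>j. of_nat j * u_deriv (c j) - v_deriv (c j)) f
      - rec_op d (\<lambda>j. u_deriv (c j)) (\<lambda>n. of_nat n * f n)) n"
    by (simp add: algebra_simps)
qed

theorem theorem1p4:
  fixes f :: "nat \<Rightarrow> 'k :: number_field poly fract"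
  assumes "q_holonomic f"
  shows "q_holonomic (\<lambda>n. rat_deriv (f n))"
proof -
  obtain d c where c: "c d \<noteq> 0" and f: "rec_op d c f = 0"
    using assms unfolding q_holonomic_iff by blast
  define g where "g = (\<lambda>n. of_nat n * f n)"
  define f' where "f' = (\<lambda>n. rat_deriv (f n))"
  define E where "E = (\<Union>j<d. {shift j f, shift j g, shift j f'})"
  have E: "shift j f \<in> seq.saturation E" "shift j g \<in> seq.saturation E"
    "shift j f' \<in> seq.saturation E" if "j < d" for j
    using that by (auto simp: E_def intro!: seq.in_saturation)
  have f_in: "shift i f \<in> seq.saturation E" for i
  proof (rule shift_in_saturated[where c = c and d = d, OF c])
    show "shift k (rec_op d c f) \<in> seq.saturation E" for k
      using seq.subspace_0[OF seq.subspace_saturation, of E]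
      by (simp add: f shift_def zero_fun_def)
  qed (rule E)
  have g_in: "shift i g \<in> seq.saturation E" for i
  proof (rule shift_in_saturated[where c = c and d = d, OF c])
    show "shift k (rec_op d c g) \<in> seq.saturation E" for k
      unfolding g_def rec_op_index_mult[OF f] by (intro shift_rec_op_in_saturation f_in)
  qed (rule E)
  have f'_in: "shift i f' \<in> seq.saturation E" for i
  proof (rule shift_in_saturated[where c = "\<lambda>j. [:[:0, 1:]:] * c j" and d = d])
    show "[:[:0, 1:]:] * c d \<noteq> 0"
      using c by simp
    have shift_diff: "shift k (s - t) = shift k s - shift k t" for k and s t :: "nat \<Rightarrow> 'k poly fract"
      by (simp add: shift_def fun_eq_iff)
    show "shift k (rec_op d (\<lambda>j. [:[:0, 1:]:] * c j) f') \<in> seq.saturation E" for k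
      unfolding f'_def rec_op_rat_deriv[OF f] shift_diff
      by (intro seq.subspace_diff seq.subspace_saturation shift_rec_op_in_saturation
          f_in g_in[unfolded g_def])
  qed (rule E)
  have "finite E"
    by (simp add: E_def)
  then show ?thesis
    using q_holonomic_if_shifts_in_saturation f'_in unfolding f'_def by blast
qed

end
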